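(* Let $0\le c<1$ and let $(p_n)_{n\ge1}$ be a sequence in $[0,1]$ with $p_n=\Omega(n^{-c})$, and for each $n$ let $G_n$ be a random graph drawn from the Erdős–Rényi distribution $G(n,p_n)$. Then for all $\epsilon>0$ and $\delta>0$ there exists $N$ such that for all $n\ge N$, $$P[\mathrm{GAPVS}(G_n)<1+\delta]>1-\epsilon.$$
   Context: $p_n=\Omega(n^{-c})$ means there exist $k>0$ and $n_0$ with $p_n \ge k n^{-c}$ for all $n\ge n_0$. The distribution $G(n,p)$ on graphs with vertex set of size $n$ includes each of the $\binom{n}{2}$ possible edges independently with probability $p$. For an undirected graph $G=(V,E)$ with $|V|=n$, a layout is a bijection $\phi:V\to\{1,\dots,n\}$. For $1\le i\le n$, let $\sigma(i,\phi,G)$ be the number of vertices $u$ with $\phi(u)\le i$ for which there exists $v$ with $\phi(v)>i$ and $uv\in E$. Define $\mathrm{VS}(G,\phi)=\max_{1\le i\le n}\sigma(i,\phi,G)$, $\mathrm{MINVS}(G)=\min_\phi\mathrm{VS}(G,\phi)$, $\mathrm{MAXVS}(G)=\max_\phi\mathrm{VS}(G,\phi)$ over all layouts $\phi$, and $\mathrm{GAPVS}(G)=\mathrm{MAXVS}(G)/\mathrm{MINVS}(G)$. *)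

theory Defs
  imports "HOL-Probability.Probability" "HOL-Probability.Product_PMF"
begin

text \<open>A finite simple graph is given by its vertex set \<open>V\<close> and its edge set \<open>E\<close>, a set of
  two-element subsets of \<open>V\<close>.\<close>

definition all_edges :: "'a set \<Rightarrow> 'a set set" where
  "all_edges V = {e. e \<subseteq> V \<and> card e = 2}"

text \<open>The distribution of the edge set of \<open>G(n,p)\<close> on the vertex set \<open>{1..n}\<close>.\<close>

definition Gnp :: "nat \<Rightarrow> real \<Rightarrow> nat set set pmf" where
  "Gnp n p =
     map_pmf (\<lambda>present. {e \<in> all_edges {1..n}. present e})
       (Pi_pmf (all_edges {1..n}) False (\<lambda>_. bernoulli_pmf p))"

text \<open>Extensionality selects one total function per bijection \<open>V \<rightarrow> {1..card V}\<close>, so that a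
  finite \<open>V\<close> has finitely many layouts.\<close>

definition layouts :: "'a set \<Rightarrow> ('a \<Rightarrow> nat) set" where
  "layouts V = {\<phi> \<in> extensional V. bij_betw \<phi> V {1..card V}}"

definition cut_size :: "nat \<Rightarrow> ('a \<Rightarrow> nat) \<Rightarrow> 'a set \<Rightarrow> 'a set set \<Rightarrow> nat" where
  "cut_size i \<phi> V E = card {u \<in> V. \<phi> u \<le> i \<and> (\<exists>v\<in>V. \<phi> v > i \<and> {u, v} \<in> E)}"

text \<open>The maxima and minima below are meaningful for finite nonempty \<open>V\<close>.\<close>

definition VS :: "'a set \<Rightarrow> 'a set set \<Rightarrow> ('a \<Rightarrow> nat) \<Rightarrow> nat" where
  "VS V E \<phi> = Max ((\<lambda>i. cut_size i \<phi> V E) ` {1..card V})"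

definition MINVS :: "'a set \<Rightarrow> 'a set set \<Rightarrow> nat" where
  "MINVS V E = Min (VS V E ` layouts V)"

definition MAXVS :: "'a set \<Rightarrow> 'a set set \<Rightarrow> nat" where
  "MAXVS V E = Max (VS V E ` layouts V)"

text \<open>The quotient is undefined on edgeless graphs, where both \<open>MINVS\<close> and \<open>MAXVS\<close> are \<open>0\<close>;
  there the totalised division gives the meaningless value \<open>0\<close>.\<close>

definition GAPVS :: "'a set \<Rightarrow> 'a set set \<Rightarrow> real" where
  "GAPVS V E = real (MAXVS V E) / real (MINVS V E)"

end

theory Submission
  imports Defs "HOL-Real_Asymp.Real_Asymp"
begin

text \<open>\<open>MAXVS\<close> never exceeds \<open>n\<close>. Conversely, suppose that any two disjoint \<open>m\<close>-sets of vertices are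
  joined by an edge. Cut an arbitrary layout before its last \<open>m\<close> vertices: fewer than \<open>m\<close> of the
  first \<open>n - m\<close> vertices can lack a neighbour beyond the cut, so \<open>MINVS \<ge> n - 2m\<close>.
  For \<open>m \<approx> \<theta>n\<close> a union bound over at most \<open>4\<^sup>n\<close> pairs shows that the hypothesis fails with
  probability at most \<open>4\<^sup>n (1-p)\<^bsup>m\<^sup>2\<^esup> \<le> exp (2n - p m\<^sup>2)\<close>, and \<open>p m\<^sup>2\<close> is of order at least
  \<open>n\<^bsup>2-c\<^esup>\<close>, which dominates \<open>n\<close>.\<close>

text \<open>Says that no bipartite hole of size \<open>m\<close> exists: the complement of the graph
  has no subgraph K_{m,m}. Unlike a bound on every cut, this is a condition on set pairs alone, with
  no layout in it.\<close>

definition joins_disjoint :: "nat \<Rightarrow> 'a set \<Rightarrow> 'a set set \<Rightarrow> bool" where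
  "joins_disjoint m V E \<longleftrightarrow>
     (\<forall>A B. A \<subseteq> V \<and> B \<subseteq> V \<and> A \<inter> B = {} \<and> card A = m \<and> card B = m \<longrightarrow>
       (\<exists>a\<in>A. \<exists>b\<in>B. {a, b} \<in> E))"

lemma finite_layouts:
  assumes "finite V"
  shows "finite (layouts V)"
proof (rule finite_subset)
  show "layouts V \<subseteq> V \<rightarrow>\<^sub>E {1..card V}"
    by (auto simp: layouts_def PiE_def bij_betw_def)
  show "finite (V \<rightarrow>\<^sub>E {1..card V})"
    using assms by (simp add: finite_PiE)
qed

lemma layouts_nonempty:
  assumes "finite V"
  shows "layouts V \<noteq> {}"
proof -
  obtain h where "bij_betw h V {1..card V}"
    using finite_same_card_bij[OF assms, of "{1..card V}"] by auto
  then have "restrict h V \<in> layouts V"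
    by (simp add: layouts_def bij_betw_restrict_eq)
  then show ?thesis by blast
qed

lemma VS_le_card:
  assumes "finite V" and "V \<noteq> {}"
  shows "VS V E \<phi> \<le> card V"
proof -
  have "cut_size i \<phi> V E \<le> card V" for i
    unfolding cut_size_def by (rule card_mono[OF assms(1)]) blast
  moreover have "{1..card V} \<noteq> {}"
    using assms by (simp add: Suc_le_eq card_gt_0_iff)
  ultimately show ?thesis
    unfolding VS_def by (intro Max.boundedI) auto
qed

lemma MAXVS_le_card:
  assumes "finite V" and "V \<noteq> {}"
  shows "MAXVS V E \<le> card V"
  unfolding MAXVS_def using VS_le_card[OF assms] finite_layouts[OF assms(1)]
    layouts_nonempty[OF assms(1)]
  by (intro Max.boundedI) auto

text \<open>The loss is \<open>2 * m\<close> because \<open>m\<close> vertices lie beyond the cut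
  and fewer than \<open>m\<close> before it have no neighbour there.\<close>

lemma VS_ge_if_joins_disjoint:
  assumes fin: "finite V" and \<phi>: "\<phi> \<in> layouts V"
    and joins: "joins_disjoint m V E" and m: "2 * m < card V"
  shows "card V - 2 * m \<le> VS V E \<phi>"
proof -
  let ?i = "card V - m"
  define F where "F = {u \<in> V. \<phi> u \<le> ?i}"
  define B where "B = {u \<in> V. \<phi> u > ?i}"
  define C where "C = {u \<in> V. \<phi> u \<le> ?i \<and> (\<exists>v\<in>V. \<phi> v > ?i \<and> {u, v} \<in> E)}"
  have bij: "bij_betw \<phi> V {1..card V}" using \<phi> by (simp add: layouts_def)
  then have im: "\<phi> ` V = {1..card V}" and inj: "inj_on \<phi> V"
    by (auto simp: bij_betw_def)
  have "\<phi> ` B = {u \<in> \<phi> ` V. u > ?i}" by (auto simp: B_def)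
  also have "\<dots> = {?i<..card V}" unfolding im by auto
  finally have "card (\<phi> ` B) = m" using m by simp
  then have cardB: "card B = m"
    using inj by (metis (no_types, lifting) B_def card_image inj_on_subset mem_Collect_eq subsetI)
  have FB: "F \<union> B = V" "F \<inter> B = {}" by (auto simp: F_def B_def)
  have "card F + card B = card V"
    using card_Un_disjoint[of F B] FB fin by (metis finite_Un)
  then have cardF: "card F = ?i" using cardB by simp
  have CF: "C \<subseteq> F" by (auto simp: C_def F_def)
  have finF: "finite F" using fin by (simp add: F_def)
  have "card (F - C) < m"
  \<comment> \<open>Vertices of \<open>F - C\<close> have no neighbour in \<open>B\<close>, so any
    \<open>m\<close> of them would form a forbidden pair with \<open>B\<close>.\<close>
  proof (rule ccontr)
    assume "\<not> card (F - C) < m"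
    then obtain A where A: "A \<subseteq> F - C" "card A = m"
      by (meson not_less obtain_subset_with_card_n)
    then have "A \<subseteq> V" "B \<subseteq> V" "A \<inter> B = {}" using FB by auto
    with A cardB joins obtain a b where "a \<in> A" "b \<in> B" "{a, b} \<in> E"
      unfolding joins_disjoint_def by blast
    with A show False by (auto simp: F_def B_def C_def)
  qed
  moreover have "card (F - C) = card F - card C"
    using CF finF by (simp add: card_Diff_subset finite_subset)
  ultimately have "card V - 2 * m \<le> card C" using cardF by linarith
  also have "card C = cut_size ?i \<phi> V E" by (simp add: C_def cut_size_def)
  \<comment> \<open>By \<open>m\<close>, the index \<open>card V - m\<close> is at least 1, so it
    lies in the range of the maximum.\<close>
  also have "\<dots> \<le> VS V E \<phi>"
    unfolding VS_def using m by (intro Max_ge) auto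
  finally show ?thesis .
qed

lemma MINVS_ge_if_joins_disjoint:
  assumes "finite V" and "joins_disjoint m V E" and "2 * m < card V"
  shows "card V - 2 * m \<le> MINVS V E"
  unfolding MINVS_def using VS_ge_if_joins_disjoint[OF assms(1) _ assms(2,3)]
    finite_layouts[OF assms(1)] layouts_nonempty[OF assms(1)]
  by (intro Min.boundedI) auto

text \<open>Disjointness shows which endpoint of an edge comes from which side, so an unordered pair
  determines the ordered one.\<close>

lemma card_edges_between:
  assumes "A \<inter> B = {}"
  shows "card ((\<lambda>(a, b). {a, b}) ` (A \<times> B)) = card A * card B"
proof -
  have "inj_on (\<lambda>(a, b). {a, b}) (A \<times> B)"
    using assms by (auto simp: inj_on_def doubleton_eq_iff)
  then show ?thesis by (simp add: card_image card_cartesian_product)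
qed

lemma prob_Gnp_disjoint:
  assumes S: "S \<subseteq> all_edges {1..n}" and p: "0 \<le> p" "p \<le> 1"
  shows "measure_pmf.prob (Gnp n p) {E. S \<inter> E = {}} = (1 - p) ^ card S"
proof -
  let ?U = "all_edges {1..n}"
  let ?B = "\<lambda>e. if e \<in> S then {False} else UNIV"
  have fin: "finite ?U"
    by (rule finite_subset[of _ "Pow {1..n}"]) (auto simp: all_edges_def)
  \<comment> \<open>The event is a box in the product space: edges in \<open>S\<close> are forced to
    be absent, all others are free. Its probability therefore factorises.\<close>
  have "measure_pmf.prob (Gnp n p) {E. S \<inter> E = {}} =
      measure_pmf.prob (Pi_pmf ?U False (\<lambda>_. bernoulli_pmf p)) (Pi ?U ?B)"
    unfolding Gnp_def measure_map_pmf
    by (rule arg_cong[where f = "measure_pmf.prob _"]) (use S in \<open>auto simp: Pi_def\<close>)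
  also have "\<dots> = (\<Prod>e\<in>?U. measure_pmf.prob (bernoulli_pmf p) (?B e))"
    by (rule measure_Pi_pmf_Pi[OF fin])
  also have "\<dots> = (\<Prod>e\<in>?U. if e \<in> S then 1 - p else 1)"
    using p by (intro prod.cong) (auto simp: measure_pmf_single)
  also have "\<dots> = (1 - p) ^ card S"
    using S fin by (simp add: prod.If_cases Int_absorb1)
  finally show ?thesis .
qed

text \<open>Each fixed pair fails only if all of its \<open>m * m\<close> potential edges are
  absent; a union bound over the pairs follows.\<close>

lemma prob_Gnp_not_joins_disjoint:
  assumes p: "0 \<le> p" "p \<le> 1"
  shows "measure_pmf.prob (Gnp n p) {E. \<not> joins_disjoint m {1..n} E} \<le>
    exp (2 * real n - p * (real m)\<^sup>2)"
proof -
  let ?V = "{1..n}"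
  define I where "I = {(A, B). A \<subseteq> ?V \<and> B \<subseteq> ?V \<and> A \<inter> B = {} \<and> card A = m \<and> card B = m}"
  define S :: "nat set \<times> nat set \<Rightarrow> nat set set"
    where "S = (\<lambda>(A, B). (\<lambda>(a, b). {a, b}) ` (A \<times> B))"
  have I_sub: "I \<subseteq> Pow ?V \<times> Pow ?V" by (auto simp: I_def)
  then have finI: "finite I" by (rule finite_subset) simp
  \<comment> \<open>Counting all pairs of subsets is crude, but costs only a factor exponential in
    \<open>n\<close>.\<close>
  have "card I \<le> card (Pow ?V \<times> Pow ?V)" by (intro card_mono I_sub) simp
  also have "\<dots> = 4 ^ n"
    by (simp add: card_cartesian_product card_Pow flip: power_mult_distrib)
  finally have cardI: "card I \<le> 4 ^ n" .
  have "measure_pmf.prob (Gnp n p) {E. \<not> joins_disjoint m ?V E} \<le>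
      measure_pmf.prob (Gnp n p) (\<Union>x\<in>I. {E. S x \<inter> E = {}})"
  proof (rule measure_pmf.finite_measure_mono)
    show "{E. \<not> joins_disjoint m ?V E} \<subseteq> (\<Union>x\<in>I. {E. S x \<inter> E = {}})"
    proof
      fix E assume "E \<in> {E. \<not> joins_disjoint m ?V E}"
      then obtain A B where "(A, B) \<in> I" "\<not> (\<exists>a\<in>A. \<exists>b\<in>B. {a, b} \<in> E)"
        unfolding joins_disjoint_def I_def by blast
      moreover from this have "S (A, B) \<inter> E = {}" by (auto simp: S_def)
      ultimately show "E \<in> (\<Union>x\<in>I. {E. S x \<inter> E = {}})" by blast
    qed
  qed simp
  also have "\<dots> \<le> (\<Sum>x\<in>I. measure_pmf.prob (Gnp n p) {E. S x \<inter> E = {}})"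
    by (rule measure_pmf.finite_measure_subadditive_finite[OF finI]) simp
  also have "\<dots> = (\<Sum>x\<in>I. (1 - p) ^ (m * m))"
  proof (rule sum.cong[OF refl])
    fix x assume x: "x \<in> I"
    then obtain A B where AB: "x = (A, B)" "A \<subseteq> ?V" "B \<subseteq> ?V" "A \<inter> B = {}"
      by (auto simp: I_def)
    have "{a, b} \<in> all_edges ?V" if "a \<in> A" "b \<in> B" for a b
    proof -
      have "a \<noteq> b" using AB that by blast
      then show ?thesis using AB that by (auto simp: all_edges_def)
    qed
    then have "S x \<subseteq> all_edges ?V" using AB(1) by (auto simp: S_def)
    moreover have "card (S x) = m * m"
      using x by (auto simp: I_def S_def card_edges_between)
    ultimately show "measure_pmf.prob (Gnp n p) {E. S x \<inter> E = {}} = (1 - p) ^ (m * m)"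
      using prob_Gnp_disjoint p by metis
  qed
  also have "\<dots> = real (card I) * (1 - p) ^ (m * m)" by simp
  also have "\<dots> \<le> 4 ^ n * (1 - p) ^ (m * m)"
  proof (rule mult_right_mono)
    show "real (card I) \<le> 4 ^ n" using of_nat_mono[OF cardI, where ?'a = real] by simp
  qed (use p in simp)
  also have "\<dots> \<le> exp 2 ^ n * exp (- p) ^ (m * m)"
  proof (intro mult_mono power_mono)
    have "(2::real) \<le> exp 1" using exp_ge_add_one_self[of "1::real"] by simp
    then have "2 * 2 \<le> exp (1::real) * exp 1" by (intro mult_mono) auto
    then show "(4::real) \<le> exp 2" by (simp flip: exp_add)
    show "1 - p \<le> exp (- p)" using exp_ge_add_one_self[of "- p"] by simp
  qed (use p in auto)
  also have "\<dots> = exp (2 * real n - p * (real m)\<^sup>2)"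
    by (simp add: power2_eq_square algebra_simps flip: exp_of_nat_mult exp_add)
  finally show ?thesis .
qed

text \<open>Compares \<open>MAXVS\<close> \<le> \<open>card V\<close> with \<open>MINVS\<close>
  \<ge> \<open>card V - 2 * m\<close>; the numerical assumption says that the ratio of these bounds
  is below \<open>1 + \<delta>\<close>.\<close>

lemma GAPVS_less_if_joins_disjoint:
  assumes fin: "finite V" and joins: "joins_disjoint m V E"
    and m: "2 * m < card V" and \<delta>: "real (card V) < (1 + \<delta>) * (real (card V) - 2 * real m)"
  shows "MINVS V E \<noteq> 0 \<and> GAPVS V E < 1 + \<delta>"
proof -
  have ge: "card V - 2 * m \<le> MINVS V E"
    using MINVS_ge_if_joins_disjoint[OF fin joins m] .
  then have pos: "MINVS V E > 0" using m by linarith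
  have ge': "real (card V) - 2 * real m \<le> real (MINVS V E)" using ge m by linarith
  have "0 < (1 + \<delta>) * (real (card V) - 2 * real m)" using \<delta> by linarith
  then have "1 + \<delta> > 0" using m by (simp add: zero_less_mult_iff)
  have "real (MAXVS V E) \<le> real (card V)"
    using MAXVS_le_card[OF fin] m by fastforce
  also have "\<dots> < (1 + \<delta>) * (real (card V) - 2 * real m)" by (rule \<delta>)
  also have "\<dots> \<le> (1 + \<delta>) * real (MINVS V E)"
    using ge' \<open>1 + \<delta> > 0\<close> by (intro mult_left_mono) auto
  finally show ?thesis
    using pos by (simp add: GAPVS_def pos_divide_less_eq)
qed

text \<open>The event includes \<open>MINVS\<close> being nonzero, since otherwise an edgeless graph
  would count as a success through division by zero giving 0.\<close>

theorem theorem5: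
  fixes c :: real and p :: "nat \<Rightarrow> real"
  assumes "0 \<le> c" and "c < 1"
    and "\<And>n. n \<ge> 1 \<Longrightarrow> 0 \<le> p n \<and> p n \<le> 1"
    and "\<exists>k>0. \<exists>n\<^sub>0. \<forall>n\<ge>n\<^sub>0. p n \<ge> k * real n powr (- c)"
  shows "\<forall>\<epsilon>>0. \<forall>\<delta>>0. \<exists>N. \<forall>n\<ge>N.
    measure_pmf.prob (Gnp n (p n))
      {E. MINVS {1..n} E \<noteq> 0 \<and> GAPVS {1..n} E < 1 + \<delta>} > 1 - \<epsilon>"
proof (intro allI impI)
  fix \<epsilon> \<delta> :: real assume \<epsilon>: "\<epsilon> > 0" and \<delta>: "\<delta> > 0"
  obtain k n0 where k: "k > 0" and pn: "\<And>n. n \<ge> n0 \<Longrightarrow> p n \<ge> k * real n powr (- c)"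
    using assms(4) by blast
  \<comment> \<open>Chosen so that \<open>(1 + \<delta>) * (1 - 2 * \<theta>)\<close> equals
    \<open>1 + \<delta> / 2\<close>, leaving room for the strict inequality.\<close>
  define \<theta> where "\<theta> = \<delta> / (4 * (1 + \<delta>))"
  have \<theta>: "\<theta> > 0" using \<delta> by (simp add: \<theta>_def)
  have \<theta>\<delta>: "(1 + \<delta>) * (1 - 2 * \<theta>) > 1"
    using \<delta> by (simp add: \<theta>_def field_simps add_pos_pos)
  have \<theta>1: "2 * \<theta> < 1" using \<delta> by (simp add: \<theta>_def field_simps)
  have lim1: "filterlim (\<lambda>n. real n powr (1 - c)) at_top sequentially"
    using assms(2)
    by (intro filterlim_compose[OF real_powr_at_top filterlim_real_sequentially]) auto
  \<comment> \<open>The bound \<open>2 / \<theta>\<close> keeps the floor in \<open>m\<close> above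
    half of \<open>\<theta> * n\<close>; the bound with 12 gives \<open>p n * m^2\<close> \<ge>
    \<open>3 * n\<close>; the last makes the resulting exponent, at most \<open>- n\<close>,
    strictly less than \<open>ln \<epsilon>\<close>.\<close>
  have ev: "\<forall>\<^sub>F n in sequentially. 1 \<le> n \<and> n0 \<le> n \<and> 2 / \<theta> \<le> real n \<and>
      12 / (k * \<theta>\<^sup>2) \<le> real n powr (1 - c) \<and> - ln \<epsilon> + 1 \<le> real n"
    using lim1 filterlim_real_sequentially
    by (intro eventually_conj eventually_ge_at_top) (auto simp: filterlim_at_top)
  have "1 - \<epsilon> < measure_pmf.prob (Gnp n (p n))
      {E. MINVS {1..n} E \<noteq> 0 \<and> GAPVS {1..n} E < 1 + \<delta>}"
    if n: "1 \<le> n" "n0 \<le> n" "2 / \<theta> \<le> real n"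
      "12 / (k * \<theta>\<^sup>2) \<le> real n powr (1 - c)" "- ln \<epsilon> + 1 \<le> real n" for n
  proof -
    let ?P = "measure_pmf.prob (Gnp n (p n))"
    let ?good = "{E. MINVS {1..n} E \<noteq> 0 \<and> GAPVS {1..n} E < 1 + \<delta>}"
    \<comment> \<open>The floor serves both sides: \<open>m\<close> \<le>
      \<open>\<theta> * n\<close> controls the gap, and \<open>m\<close> \<ge>
      \<open>\<theta> * n / 2\<close> controls the failure probability.\<close>
    define m where "m = nat \<lfloor>\<theta> * real n\<rfloor>"
    have nonneg: "0 \<le> \<theta> * real n" using \<theta> by simp
    have m_le: "real m \<le> \<theta> * real n" using nonneg by (simp add: m_def)
    have "2 \<le> \<theta> * real n" using n(3) \<theta> by (simp add: field_simps)
    moreover have "real m > \<theta> * real n - 1" using nonneg unfolding m_def by linarith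
    ultimately have m_ge: "\<theta> * real n / 2 \<le> real m" by linarith
    have rn: "real n > 0" using n(1) by simp
    have "2 * \<theta> * real n < real n" using \<theta>1 rn by simp
    then have m_small: "2 * m < card {1..n}" using m_le by simp
    have "real n < real n * ((1 + \<delta>) * (1 - 2 * \<theta>))" using \<theta>\<delta> rn by simp
    also have "\<dots> = (1 + \<delta>) * (real n - 2 * (\<theta> * real n))" by (simp add: algebra_simps)
    also have "\<dots> \<le> (1 + \<delta>) * (real n - 2 * real m)"
      using m_le \<delta> by (intro mult_left_mono) auto
    finally have gap: "real (card {1..n}) < (1 + \<delta>) * (real (card {1..n}) - 2 * real m)"
      by simp
    have p01: "0 \<le> p n" "p n \<le> 1" using assms(3) n(1) by auto
    \<comment> \<open>Here \<open>c < 1\<close> enters: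
      \<open>k * n powr (- c) * (\<theta> * n / 2)^2\<close> is \<open>n\<close> times a multiple of
      \<open>n powr (1 - c)\<close>, which is unbounded. The 4 comes from squaring the half.\<close>
    have "3 * real n \<le> k * \<theta>\<^sup>2 / 4 * real n powr (1 - c) * real n"
    proof (rule mult_right_mono)
      show "3 \<le> k * \<theta>\<^sup>2 / 4 * real n powr (1 - c)"
        using n(4) k \<theta> by (simp add: field_simps)
    qed simp
    also have "real n powr (1 - c) = real n powr (- c) * real n"
      using rn by (simp add: powr_diff powr_minus field_simps)
    also have "k * \<theta>\<^sup>2 / 4 * (real n powr (- c) * real n) * real n =
        (k * real n powr (- c)) * (\<theta> * real n / 2)\<^sup>2"
      by (simp add: power2_eq_square)
    also have "\<dots> \<le> p n * (real m)\<^sup>2"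
      using pn[OF n(2)] m_ge nonneg p01 by (intro mult_mono power_mono) auto
    finally have expo: "2 * real n - p n * (real m)\<^sup>2 < ln \<epsilon>" using n(5) by linarith
    have "?P {E. \<not> joins_disjoint m {1..n} E} \<le> exp (2 * real n - p n * (real m)\<^sup>2)"
      by (rule prob_Gnp_not_joins_disjoint[OF p01])
    also have "\<dots> < \<epsilon>" using expo \<epsilon> by (metis exp_less_cancel_iff exp_ln)
    finally have "1 - \<epsilon> < 1 - ?P {E. \<not> joins_disjoint m {1..n} E}" by simp
    also have "\<dots> = ?P {E. joins_disjoint m {1..n} E}"
      using measure_pmf.prob_compl[of "{E. \<not> joins_disjoint m {1..n} E}" "Gnp n (p n)"]
      by (simp add: Compl_eq_Diff_UNIV[symmetric] Collect_neg_eq)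
    also have "\<dots> \<le> ?P ?good"
      by (rule measure_pmf.finite_measure_mono)
        (use GAPVS_less_if_joins_disjoint[OF _ _ m_small gap] in auto)
    finally show ?thesis .
  qed
  then show "\<exists>N. \<forall>n\<ge>N. 1 - \<epsilon> < measure_pmf.prob (Gnp n (p n))
      {E. MINVS {1..n} E \<noteq> 0 \<and> GAPVS {1..n} E < 1 + \<delta>}"
    using ev unfolding eventually_sequentially by meson
qed

end
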